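(* Let $A_k$ be the current agent with failure rate $Z_k\in(0,1)$ and let $\delta\ge 0$. Assume the reward takes values in $[0,1]$ and the user-task distribution $\mathcal D_{\mathrm{user}}$ does not depend on the agent. Then every candidate agent $\widetilde A$ with $D_R(\widetilde A;A_k)\le\delta$ satisfies $$J_{\mathrm{user}}(\widetilde A)-J_{\mathrm{user}}(A_k)\ \ge\ L_{A_k}(\widetilde A)-(1-Z_k)\delta .$$
   Context: $\mathcal T_{\mathrm{user}}$ (user tasks) and $\mathcal O$ (outputs) are measurable spaces. An agent $A$ is a Markov kernel $A(\cdot\mid t)$ from $\mathcal T_{\mathrm{user}}$ to $\mathcal O$. The reward $r:\mathcal T_{\mathrm{user}}\times\mathcal O\to[0,1]$ and failure detector $\phi:\mathcal T_{\mathrm{user}}\times\mathcal O\to\{0,1\}$ are jointly measurable and fixed; $\mathcal D_{\mathrm{user}}$ is a probability measure on $\mathcal T_{\mathrm{user}}$, the same for all agents. Define $V(A,t)=\int r(t,o)A(do\mid t)$, $J_{\mathrm{user}}(A)=\int V(A,t)\,\mathcal D_{\mathrm{user}}(dt)$, $\psi_A(t)=\int\phi(t,o)A(do\mid t)$, and $Z_k=\int\psi_{A_k}\,d\mathcal D_{\mathrm{user}}$. For $0<Z_k<1$ define the failure-task and retained-task distributions $$\mathcal D_{F,k}(dt)=\frac{\psi_{A_k}(t)}{Z_k}\mathcal D_{\mathrm{user}}(dt),\qquad \mathcal D_{R,k}(dt)=\frac{1-\psi_{A_k}(t)}{1-Z_k}\mathcal D_{\mathrm{user}}(dt).$$ For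 a candidate agent $\widetilde A$ (any agent) put $\mathrm{Adv}_{A_k}(\widetilde A,t)=V(\widetilde A,t)-V(A_k,t)$, $L_{A_k}(\widetilde A)=Z_k\,\mathbb E_{t\sim\mathcal D_{F,k}}[\mathrm{Adv}_{A_k}(\widetilde A,t)]$ and $D_R(\widetilde A;A_k)=\mathbb E_{t\sim\mathcal D_{R,k}}|\mathrm{Adv}_{A_k}(\widetilde A,t)|$. *)

theory Defs
  imports "HOL-Probability.Probability"
begin

text \<open>
  \<open>T\<close> and \<open>Out\<close> stand for the measurable spaces of user tasks and of outputs (only their
  sigma-algebras matter); \<open>D\<close> is the user-task distribution, a probability measure on \<open>T\<close>.
  Agents are Markov kernels from \<open>T\<close> to \<open>Out\<close>. The failure detector is real-valued,
  with values in \<open>{0, 1}\<close>.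
\<close>

definition agents :: "'t measure \<Rightarrow> 'o measure \<Rightarrow> ('t \<Rightarrow> 'o measure) set" where
  "agents T Out = T \<rightarrow>\<^sub>M prob_algebra Out"

definition task_value :: "('t \<times> 'o \<Rightarrow> real) \<Rightarrow> ('t \<Rightarrow> 'o measure) \<Rightarrow> 't \<Rightarrow> real" where
  "task_value r A t = (\<integral>y. r (t, y) \<partial>A t)"

definition J_user :: "'t measure \<Rightarrow> ('t \<times> 'o \<Rightarrow> real) \<Rightarrow> ('t \<Rightarrow> 'o measure) \<Rightarrow> real" where
  "J_user D r A = (\<integral>t. task_value r A t \<partial>D)"

definition failure_prob :: "('t \<times> 'o \<Rightarrow> real) \<Rightarrow> ('t \<Rightarrow> 'o measure) \<Rightarrow> 't \<Rightarrow> real" where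
  "failure_prob \<phi> A t = (\<integral>y. \<phi> (t, y) \<partial>A t)"

definition failure_rate :: "'t measure \<Rightarrow> ('t \<times> 'o \<Rightarrow> real) \<Rightarrow> ('t \<Rightarrow> 'o measure) \<Rightarrow> real" where
  "failure_rate D \<phi> A = (\<integral>t. failure_prob \<phi> A t \<partial>D)"

text \<open>
  The next two measures are the intended probability distributions only when the failure rate
  lies strictly between 0 and 1.
\<close>

definition failure_tasks ::
    "'t measure \<Rightarrow> ('t \<times> 'o \<Rightarrow> real) \<Rightarrow> ('t \<Rightarrow> 'o measure) \<Rightarrow> 't measure" where
  "failure_tasks D \<phi> A =
     density D (\<lambda>t. ennreal (failure_prob \<phi> A t / failure_rate D \<phi> A))"

definition retained_tasks ::
    "'t measure \<Rightarrow> ('t \<times> 'o \<Rightarrow> real) \<Rightarrow> ('t \<Rightarrow> 'o measure) \<Rightarrow> 't measure" where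
  "retained_tasks D \<phi> A =
     density D (\<lambda>t. ennreal ((1 - failure_prob \<phi> A t) / (1 - failure_rate D \<phi> A)))"

text \<open>In the following, \<open>A\<close> is the current agent and \<open>B\<close> the candidate.\<close>

definition Adv ::
    "('t \<times> 'o \<Rightarrow> real) \<Rightarrow> ('t \<Rightarrow> 'o measure) \<Rightarrow> ('t \<Rightarrow> 'o measure) \<Rightarrow> 't \<Rightarrow> real" where
  "Adv r A B t = task_value r B t - task_value r A t"

definition surrogate_gain ::
    "'t measure \<Rightarrow> ('t \<times> 'o \<Rightarrow> real) \<Rightarrow> ('t \<times> 'o \<Rightarrow> real) \<Rightarrow>
     ('t \<Rightarrow> 'o measure) \<Rightarrow> ('t \<Rightarrow> 'o measure) \<Rightarrow> real" where
  "surrogate_gain D r \<phi> A B =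
     failure_rate D \<phi> A * (\<integral>t. Adv r A B t \<partial>failure_tasks D \<phi> A)"

definition retained_drift ::
    "'t measure \<Rightarrow> ('t \<times> 'o \<Rightarrow> real) \<Rightarrow> ('t \<times> 'o \<Rightarrow> real) \<Rightarrow>
     ('t \<Rightarrow> 'o measure) \<Rightarrow> ('t \<Rightarrow> 'o measure) \<Rightarrow> real" where
  "retained_drift D r \<phi> B A = (\<integral>t. \<bar>Adv r A B t\<bar> \<partial>retained_tasks D \<phi> A)"

end

theory Submission
  imports Defs
begin

text \<open>
  Splitting \<open>D\<close> into its failed and retained parts, \<open>J_user D r B - J_user D r A\<close> equals the
  surrogate gain plus the integral of the advantage against \<open>1 - \<psi>\<close>. The latter is at least
  minus the integral of the absolute advantage against \<open>1 - \<psi>\<close>, which is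
  \<open>1 - failure_rate D \<phi> A\<close> times the drift.
\<close>

text \<open>Pushing \<open>A t\<close> forward along \<open>Pair t\<close> turns the section
  integral into the integral of the fixed function \<open>f\<close> against a measure on the
  product. That measure depends measurably on \<open>t\<close>, and integrating \<open>f\<close> is
  a measurable functional on subprobability measures.\<close>

lemma kernel_integral_measurable:
  fixes f :: "'t \<times> 'o \<Rightarrow> real"
  assumes "f \<in> borel_measurable (T \<Otimes>\<^sub>M Out)" and "A \<in> agents T Out"
  shows "(\<lambda>t. \<integral>y. f (t, y) \<partial>A t) \<in> borel_measurable T"
proof -
  have A: "A \<in> T \<rightarrow>\<^sub>M subprob_algebra Out"
    using assms(2) unfolding agents_def by (rule measurable_prob_algebraD)
  have "(\<lambda>t. distr (A t) (T \<Otimes>\<^sub>M Out) (Pair t)) \<in> T \<rightarrow>\<^sub>M subprob_algebra (T \<Otimes>\<^sub>M Out)"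
    by (rule measurable_distr2[OF _ A]) simp
  from measurable_compose[OF this integral_measurable_subprob_algebra[OF assms(1)]]
  have "(\<lambda>t. \<integral>x. f x \<partial>distr (A t) (T \<Otimes>\<^sub>M Out) (Pair t)) \<in> borel_measurable T" .
  moreover have "(\<integral>x. f x \<partial>distr (A t) (T \<Otimes>\<^sub>M Out) (Pair t)) = (\<integral>y. f (t, y) \<partial>A t)"
    if t: "t \<in> space T" for t
  proof (rule integral_distr)
    \<comment> \<open>Measurability of \<open>Pair t\<close> is known on \<open>Out\<close>; it
      carries over to \<open>A t\<close> because only the sigma-algebra matters.\<close>
    have "sets (A t) = sets Out"
      using measurable_space[OF A t] by (simp add: space_subprob_algebra)
    then show "Pair t \<in> A t \<rightarrow>\<^sub>M T \<Otimes>\<^sub>M Out"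
      using measurable_Pair1'[OF t] measurable_cong_sets by blast
  qed fact
  ultimately show ?thesis
    by (simp cong: measurable_cong)
qed

text \<open>An average against a probability measure stays within the bounds of the integrand.
  Applied to both \<open>r\<close> and \<open>\<phi>\<close>, this supplies all the bounds behind
  the integrability claims and the sign of the weights.\<close>

lemma kernel_integral_unit_interval:
  fixes f :: "'t \<times> 'o \<Rightarrow> real"
  assumes f: "f \<in> borel_measurable (T \<Otimes>\<^sub>M Out)"
    and unit: "\<And>x. x \<in> space (T \<Otimes>\<^sub>M Out) \<Longrightarrow> f x \<in> {0..1}"
    and A: "A \<in> agents T Out" and t: "t \<in> space T"
  shows "(\<integral>y. f (t, y) \<partial>A t) \<in> {0..1}"
proof -
  have "A t \<in> space (prob_algebra Out)"
    using A t unfolding agents_def by (rule measurable_space)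
  then have sets: "sets (A t) = sets Out" and "prob_space (A t)"
    by (auto simp: space_prob_algebra)
  then interpret prob_space "A t" by simp
  have bounds: "f (t, y) \<in> {0..1}" if "y \<in> space (A t)" for y
    using that t sets_eq_imp_space_eq[OF sets]
    by (intro unit) (auto simp: space_pair_measure)
  have "(\<lambda>y. f (t, y)) \<in> borel_measurable (A t)"
    using measurable_compose[OF measurable_Pair1'[OF t] f] measurable_cong_sets[OF sets refl]
    by auto
  then have "integrable (A t) (\<lambda>y. f (t, y))"
    by (rule integrable_const_bound[where B = 1, rotated]) (use bounds in auto)
  then have "(\<integral>y. f (t, y) \<partial>A t) \<le> 1"
    by (rule integral_le_const) (use bounds in auto)
  moreover have "0 \<le> (\<integral>y. f (t, y) \<partial>A t)"
    by (rule Bochner_Integration.integral_nonneg) (use bounds in auto)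
  ultimately show ?thesis by simp
qed

theorem theorem1:
  fixes T D :: "'t measure" and Out :: "'o measure"
    and r \<phi> :: "'t \<times> 'o \<Rightarrow> real"
    and A B :: "'t \<Rightarrow> 'o measure"
    and \<delta> :: real
  assumes "prob_space D" and "sets D = sets T"
    and "r \<in> borel_measurable (T \<Otimes>\<^sub>M Out)"
    and "\<And>x. x \<in> space (T \<Otimes>\<^sub>M Out) \<Longrightarrow> r x \<in> {0..1}"
    and "\<phi> \<in> borel_measurable (T \<Otimes>\<^sub>M Out)"
    and "\<And>x. x \<in> space (T \<Otimes>\<^sub>M Out) \<Longrightarrow> \<phi> x \<in> {0, 1}"
    and "A \<in> agents T Out"
    and "0 < failure_rate D \<phi> A" and "failure_rate D \<phi> A < 1"
    and "0 \<le> \<delta>"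
    and "B \<in> agents T Out"
    and "retained_drift D r \<phi> B A \<le> \<delta>"
  shows "J_user D r B - J_user D r A
           \<ge> surrogate_gain D r \<phi> A B - (1 - failure_rate D \<phi> A) * \<delta>"
proof -
  interpret prob_space D by fact
  define Z where "Z = failure_rate D \<phi> A"
  define \<psi> where "\<psi> = failure_prob \<phi> A"
  define a where "a = Adv r A B"
  \<comment> \<open>The kernel lemmas speak of \<open>T\<close>; these two facts carry them over to
    \<open>D\<close>.\<close>
  note space_D = sets_eq_imp_space_eq[OF \<open>sets D = sets T\<close>]
  note meas_D = measurable_cong_sets[OF \<open>sets D = sets T\<close> refl]
  have Z: "0 < Z" "Z < 1" using assms(8,9) by (simp_all add: Z_def)

  have [measurable]: "task_value r C \<in> borel_measurable D" if "C \<in> agents T Out" for C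
    unfolding task_value_def meas_D by (rule kernel_integral_measurable) fact+
  have value_bounds: "task_value r C t \<in> {0..1}" if "C \<in> agents T Out" "t \<in> space D" for C t
    using kernel_integral_unit_interval[OF assms(3,4) that(1)] that(2)
    by (simp add: task_value_def space_D)
  have [measurable]: "\<psi> \<in> borel_measurable D"
    unfolding \<psi>_def failure_prob_def meas_D by (rule kernel_integral_measurable) fact+
  have \<psi>_bounds: "0 \<le> \<psi> t \<and> \<psi> t \<le> 1" if "t \<in> space D" for t
    using kernel_integral_unit_interval[OF assms(5) _ assms(7), of t] assms(6) that
    by (fastforce simp: \<psi>_def failure_prob_def space_D)
  have [measurable]: "a \<in> borel_measurable D"
    unfolding a_def Adv_def using assms(7,11) by measurable
  have a_bound: "\<bar>a t\<bar> \<le> 1" if "t \<in> space D" for t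
    using value_bounds[OF assms(7) that] value_bounds[OF assms(11) that]
    by (auto simp: a_def Adv_def)

  have value_int: "integrable D (task_value r C)" if "C \<in> agents T Out" for C
    using that by (intro integrable_const_bound[where B = 1]) (use value_bounds in auto)
  \<comment> \<open>Here and in the next two facts both factors have absolute value at most 1, so
    the product is bounded by 1, which suffices on a probability space.\<close>
  have \<psi>a_int: "integrable D (\<lambda>t. \<psi> t * a t)"
    by (intro integrable_const_bound[where B = 1] AE_I2)
      (auto simp: abs_mult intro!: mult_le_one a_bound dest: \<psi>_bounds)
  have ra_int: "integrable D (\<lambda>t. (1 - \<psi> t) * a t)"
    by (intro integrable_const_bound[where B = 1] AE_I2)
      (auto simp: abs_mult intro!: mult_le_one a_bound dest: \<psi>_bounds)
  have rabs_int: "integrable D (\<lambda>t. (1 - \<psi> t) * \<bar>a t\<bar>)"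
    by (intro integrable_const_bound[where B = 1] AE_I2)
      (auto simp: abs_mult intro!: mult_le_one a_bound dest: \<psi>_bounds)

  \<comment> \<open>The prefactor \<open>Z\<close> cancels the normalisation of the failure density,
    since \<open>Z\<close> is nonzero.\<close>
  have gain: "surrogate_gain D r \<phi> A B = (\<integral>t. \<psi> t * a t \<partial>D)"
  proof -
    have "(\<integral>t. a t \<partial>failure_tasks D \<phi> A) = (\<integral>t. \<psi> t / Z * a t \<partial>D)"
      unfolding failure_tasks_def \<psi>_def[symmetric] Z_def[symmetric]
      by (subst integral_density) (use Z \<psi>_bounds in auto)
    also have "\<dots> = (\<integral>t. \<psi> t * a t \<partial>D) / Z"
      by (simp flip: Bochner_Integration.integral_divide_zero)
    finally show ?thesis
      using Z by (simp add: surrogate_gain_def a_def[symmetric] Z_def[symmetric])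
  qed
  \<comment> \<open>The same cancellation for the retained density, now using
    \<open>Z < 1\<close>.\<close>
  have drift: "(1 - Z) * retained_drift D r \<phi> B A = (\<integral>t. (1 - \<psi> t) * \<bar>a t\<bar> \<partial>D)"
  proof -
    have "(\<integral>t. \<bar>a t\<bar> \<partial>retained_tasks D \<phi> A) = (\<integral>t. (1 - \<psi> t) / (1 - Z) * \<bar>a t\<bar> \<partial>D)"
      unfolding retained_tasks_def \<psi>_def[symmetric] Z_def[symmetric]
      by (subst integral_density) (use Z \<psi>_bounds in auto)
    also have "\<dots> = (\<integral>t. (1 - \<psi> t) * \<bar>a t\<bar> \<partial>D) / (1 - Z)"
      by (simp flip: Bochner_Integration.integral_divide_zero)
    finally show ?thesis
      using Z by (simp add: retained_drift_def a_def[symmetric])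
  qed

  have "J_user D r B - J_user D r A = (\<integral>t. a t \<partial>D)"
    using value_int assms(7,11) by (simp add: J_user_def a_def Adv_def)
  also have "\<dots> = (\<integral>t. \<psi> t * a t + (1 - \<psi> t) * a t \<partial>D)"
    by (simp add: algebra_simps)
  also have "\<dots> = surrogate_gain D r \<phi> A B + (\<integral>t. (1 - \<psi> t) * a t \<partial>D)"
    using \<psi>a_int ra_int by (simp only: gain Bochner_Integration.integral_add)
  finally have split: "J_user D r B - J_user D r A
      = surrogate_gain D r \<phi> A B + (\<integral>t. (1 - \<psi> t) * a t \<partial>D)" .
  have "- (\<integral>t. (1 - \<psi> t) * \<bar>a t\<bar> \<partial>D) = (\<integral>t. - ((1 - \<psi> t) * \<bar>a t\<bar>) \<partial>D)"
    by simp
  also have "\<dots> \<le> (\<integral>t. (1 - \<psi> t) * a t \<partial>D)"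
  proof (rule integral_mono)
    \<comment> \<open>The bound of a number below by minus its absolute value is scaled by the
      weight \<open>1 - \<psi> t\<close>, which is nonnegative.\<close>
    show "- ((1 - \<psi> t) * \<bar>a t\<bar>) \<le> (1 - \<psi> t) * a t" if "t \<in> space D" for t
      using mult_left_mono[of "- \<bar>a t\<bar>" "a t" "1 - \<psi> t"] \<psi>_bounds[OF that] by simp
  qed (use ra_int rabs_int in auto)
  finally have "- ((1 - Z) * retained_drift D r \<phi> B A) \<le> (\<integral>t. (1 - \<psi> t) * a t \<partial>D)"
    by (simp only: drift)
  moreover have "(1 - Z) * retained_drift D r \<phi> B A \<le> (1 - Z) * \<delta>"
    using assms(12) Z by (intro mult_left_mono) auto
  ultimately show ?thesis
    using split by (simp add: Z_def)
qed

end
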